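(* Let $L$ be a planar pentagonal linkage with sidelengths $a_1,a_2,a_3,a_4,a_5>0$, and let $H_5(u)$ be the Robbins polynomial associated with $(a_1,\dots,a_5)$, as defined in the context. Suppose $X$ is a convex tangential configuration of $L$ with area $A$, and suppose that $16A^2$ is the maximal real root of $H_5(u)$. Then $X$ is bicentric.
   Context: The planar pentagonal linkage $L$ with sidelengths $a_1,\dots,a_5>0$ is the collection of all planar pentagons $V_1V_2V_3V_4V_5$ in the Euclidean plane with $|V_jV_{j+1}|=a_j$ for $j=1,\dots,5$ (indices mod 5); such pentagons are the configurations of $L$. A polygon is chordal (cyclic) if all its vertices lie on one circle. It is tangential if there is a circle tangent to each side of the polygon at an inner point of that side. It is bicentric if it is both chordal and tangential. Let $e_k$ be the $k$-th elementary symmetric function of $a_1^2,\dots,a_5^2$. Put $$t_2=e_1^2+u-4e_2,\quad t_3=e_1t_2+8e_3,\quad t_4=t_2^2-64e_4,\quad t_5=128e_5.$$ The Robbins polynomial is $$H_5(u)=u\,t_4^3+t_3^2t_4^2-16\,t_3^3t_5-18\,u\,t_3t_4t_5-27\,u^2t_5^2,$$ regarded as a polynomial in $u$ (of degree 7). *)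

theory Defs
  imports "HOL-Complex_Analysis.Complex_Analysis" "HOL-Computational_Algebra.Polynomial"
begin

text \<open>The Euclidean plane is the type \<^typ>\<open>complex\<close>. Pentagons and tuples of sidelengths are functions
  on \<^typ>\<open>nat\<close> of which only the values at \<open>1, \<dots>, 5\<close> matter; \<open>nxt\<close> is the cyclic successor on this
  index set (so \<open>nxt 5 = 1\<close>).\<close>

definition nxt :: "nat \<Rightarrow> nat" where
  "nxt j = j mod 5 + 1"

definition configuration :: "(nat \<Rightarrow> real) \<Rightarrow> (nat \<Rightarrow> complex) \<Rightarrow> bool" where
  "configuration a V \<longleftrightarrow> (\<forall>j\<in>{1..5}. dist (V j) (V (nxt j)) = a j)"

definition pentagon_path :: "(nat \<Rightarrow> complex) \<Rightarrow> real \<Rightarrow> complex" where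
  "pentagon_path V =
     linepath (V 1) (V 2) +++ linepath (V 2) (V 3) +++ linepath (V 3) (V 4) +++
     linepath (V 4) (V 5) +++ linepath (V 5) (V 1)"

definition pentagon_region :: "(nat \<Rightarrow> complex) \<Rightarrow> complex set" where
  "pentagon_region V = inside (path_image (pentagon_path V))"

text \<open>A convex pentagon is a simple closed one bounding a convex region. Straight angles are not
  excluded here, but they cannot occur in a tangential pentagon.\<close>

definition convex_pentagon :: "(nat \<Rightarrow> complex) \<Rightarrow> bool" where
  "convex_pentagon V \<longleftrightarrow> simple_path (pentagon_path V) \<and> convex (pentagon_region V)"

definition pentagon_area :: "(nat \<Rightarrow> complex) \<Rightarrow> real" where
  "pentagon_area V = measure lebesgue (pentagon_region V)"

definition chordal :: "(nat \<Rightarrow> complex) \<Rightarrow> bool" where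
  "chordal V \<longleftrightarrow> (\<exists>c r. r > 0 \<and> (\<forall>j\<in>{1..5}. V j \<in> sphere c r))"

text \<open>The line through a side is tangent to the circle when it meets it in exactly one point; this
  point of tangency has to be an inner point of the side.\<close>

definition tangential :: "(nat \<Rightarrow> complex) \<Rightarrow> bool" where
  "tangential V \<longleftrightarrow> (\<exists>c r. r > 0 \<and>
     (\<forall>j\<in>{1..5}. \<exists>p\<in>open_segment (V j) (V (nxt j)).
        affine hull {V j, V (nxt j)} \<inter> sphere c r = {p}))"

definition bicentric :: "(nat \<Rightarrow> complex) \<Rightarrow> bool" where
  "bicentric V \<longleftrightarrow> chordal V \<and> tangential V"

definition esym :: "(nat \<Rightarrow> real) \<Rightarrow> nat \<Rightarrow> real" where
  "esym a k = (\<Sum>S | S \<subseteq> {1..5} \<and> card S = k. \<Prod>j\<in>S. (a j)\<^sup>2)"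

definition robbins_poly :: "(nat \<Rightarrow> real) \<Rightarrow> real poly" where
  "robbins_poly a =
     (let u = [:0, 1:];
          e = (\<lambda>k. [:esym a k:]);
          t2 = (e 1)\<^sup>2 + u - 4 * e 2;
          t3 = e 1 * t2 + 8 * e 3;
          t4 = t2\<^sup>2 - 64 * e 4;
          t5 = 128 * e 5
      in u * t4 ^ 3 + t3\<^sup>2 * t4\<^sup>2 - 16 * t3 ^ 3 * t5 - 18 * u * t3 * t4 * t5 - 27 * u\<^sup>2 * t5\<^sup>2)"

lemma poly_robbins_poly:
  "poly (robbins_poly a) u =
     (let t2 = (esym a 1)\<^sup>2 + u - 4 * esym a 2;
          t3 = esym a 1 * t2 + 8 * esym a 3;
          t4 = t2\<^sup>2 - 64 * esym a 4;
          t5 = 128 * esym a 5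
      in u * t4 ^ 3 + t3\<^sup>2 * t4\<^sup>2 - 16 * t3 ^ 3 * t5 - 18 * u * t3 * t4 * t5 - 27 * u\<^sup>2 * t5\<^sup>2)"
  by (simp add: robbins_poly_def Let_def mult_ac)

definition maximal_real_root :: "real poly \<Rightarrow> real \<Rightarrow> bool" where
  "maximal_real_root p x \<longleftrightarrow> poly p x = 0 \<and> (\<forall>y. poly p y = 0 \<longrightarrow> y \<le> x)"

end

theory Submission
  imports Defs
begin

text \<open>Choose \<open>R\<close> and angles \<open>\<theta>\<^sub>1, \<dots>, \<theta>\<^sub>5 > 0\<close> with sum \<open>\<pi>\<close> and \<open>a\<^sub>j = 2 R sin \<theta>\<^sub>j\<close>: these are the data of the
  convex cyclic pentagon with the given sides, whose area is \<open>M = \<Sum> cot \<theta>\<^sub>j a\<^sub>j\<^sup>2 / 4\<close>. Robbins' theorem says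
  that \<open>16 M\<^sup>2\<close> is a root of \<open>H\<^sub>5\<close>, so maximality gives \<open>M \<le> A\<close>. Conversely, cut any pentagon with these
  sides into a fan of triangles and apply the Neuberg--Pedoe inequality
  \<open>4 \<Delta> \<le> cot \<alpha> |d|\<^sup>2 + cot \<beta> |w|\<^sup>2 - cot (\<alpha> + \<beta>) |d + w|\<^sup>2\<close> to each of them, with partial sums of the
  \<open>\<theta>\<^sub>j\<close> as angles; the diagonals cancel and \<open>A \<le> M\<close> remains. So equality holds throughout, each
  triangle of the fan is similar to the corresponding triangle of the cyclic pentagon, and \<open>X\<close> is
  cyclic.\<close>

section \<open>Robbins' polynomial of a cyclic pentagon\<close>

text \<open>Unlike \<open>esym\<close>, this allows recursion on the index set and complex
  arguments, which are needed for the unit numbers \<open>cis (2 * \<theta> j)\<close>.\<close>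

definition esum :: "('a \<Rightarrow> 'b::comm_semiring_1) \<Rightarrow> 'a set \<Rightarrow> nat \<Rightarrow> 'b" where
  "esum b I k = (\<Sum>S | S \<subseteq> I \<and> card S = k. \<Prod>j\<in>S. b j)"

lemma esum_0: "finite I \<Longrightarrow> esum b I 0 = 1"
proof -
  assume "finite I"
  then have "{S. S \<subseteq> I \<and> card S = 0} = {{}}"
    using finite_subset by fastforce
  then show ?thesis by (simp add: esum_def)
qed

lemma esum_empty_Suc: "esum b {} (Suc k) = 0"
proof -
  have "{S. S \<subseteq> {} \<and> card S = Suc k} = {}" by auto
  then show ?thesis unfolding esum_def by (metis sum.empty)
qed

text \<open>A subset of \<open>insert x I\<close> of size k + 1 either avoids \<open>x\<close> or
  arises from exactly one subset of \<open>I\<close> of size k by adding \<open>x\<close>.\<close>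

lemma esum_insert_Suc:
  assumes "finite I" "x \<notin> I"
  shows "esum b (insert x I) (Suc k) = esum b I (Suc k) + b x * esum b I k"
proof -
  let ?F = "\<lambda>I k. {S. S \<subseteq> I \<and> card S = k}"
  have fin: "finite (?F I k)" for k
    using assms(1) by simp
  have notin: "x \<notin> S" "finite S" if "S \<subseteq> I" for S
    using that assms finite_subset by auto
  have "?F (insert x I) (Suc k) \<subseteq> ?F I (Suc k) \<union> insert x ` ?F I k"
  proof
    fix S assume S: "S \<in> ?F (insert x I) (Suc k)"
    show "S \<in> ?F I (Suc k) \<union> insert x ` ?F I k"
    proof (cases "x \<in> S")
      case True
      with S have "S - {x} \<in> ?F I k" by auto
      moreover have "S = insert x (S - {x})" using True by auto
      ultimately show ?thesis by blast
    qed (use S in auto)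
  qed
  then have split: "?F (insert x I) (Suc k) = ?F I (Suc k) \<union> insert x ` ?F I k"
    using notin by auto
  have inj: "inj_on (insert x) (?F I k)"
    using notin(1) by (intro inj_onI) (metis (mono_tags, lifting) insert_ident mem_Collect_eq)
  have "esum b (insert x I) (Suc k) =
      esum b I (Suc k) + (\<Sum>S\<in>insert x ` ?F I k. \<Prod>j\<in>S. b j)"
    unfolding esum_def split
    by (rule sum.union_disjoint) (use fin notin in auto)
  also have "(\<Sum>S\<in>insert x ` ?F I k. \<Prod>j\<in>S. b j) = (\<Sum>S\<in>?F I k. b x * (\<Prod>j\<in>S. b j))"
    using notin by (subst sum.reindex[OF inj]) (auto intro!: sum.cong simp: o_def)
  also have "\<dots> = b x * esum b I k"
    by (simp add: esum_def sum_distrib_left)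
  finally show ?thesis .
qed

lemma esum_scale: "esum (\<lambda>j. c * b j) I k = c ^ k * esum b I k"
  unfolding esum_def sum_distrib_left by (auto intro!: sum.cong simp: prod.distrib)

lemma esum_insert:
  assumes "finite I" "x \<notin> I"
  shows "esum b (insert x I) 1 = esum b I 1 + b x"
    "esum b (insert x I) (numeral n) = esum b I (numeral n) + b x * esum b I (pred_numeral n)"
  using esum_insert_Suc[OF assms, of b 0] esum_insert_Suc[OF assms, of b "pred_numeral n"]
  by (simp_all add: numeral_eq_Suc esum_0 assms)

lemma esum_empty: "esum b {} 1 = 0" "esum b {} (numeral n) = 0"
  by (simp_all add: numeral_eq_Suc esum_empty_Suc)

lemma atLeastAtMost_1_5: "{1..5} = {1, 2, 3, 4, 5::nat}"
  by auto

lemma esum_5: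
  fixes b :: "nat \<Rightarrow> 'b::comm_semiring_1"
  shows "esum b {1..5} 1 = b 1 + b 2 + b 3 + b 4 + b 5"
    "esum b {1..5} 2 = b 1 * b 2 + b 1 * b 3 + b 1 * b 4 + b 1 * b 5 + b 2 * b 3 + b 2 * b 4 + b 2 * b 5
      + b 3 * b 4 + b 3 * b 5 + b 4 * b 5"
    "esum b {1..5} 3 = b 1 * b 2 * b 3 + b 1 * b 2 * b 4 + b 1 * b 2 * b 5 + b 1 * b 3 * b 4
      + b 1 * b 3 * b 5 + b 1 * b 4 * b 5 + b 2 * b 3 * b 4 + b 2 * b 3 * b 5 + b 2 * b 4 * b 5
      + b 3 * b 4 * b 5"
    "esum b {1..5} 4 = b 1 * b 2 * b 3 * b 4 + b 1 * b 2 * b 3 * b 5 + b 1 * b 2 * b 4 * b 5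
      + b 1 * b 3 * b 4 * b 5 + b 2 * b 3 * b 4 * b 5"
    "esum b {1..5} 5 = b 1 * b 2 * b 3 * b 4 * b 5"
  unfolding atLeastAtMost_1_5
  by (simp_all add: esum_insert esum_empty esum_0 algebra_simps del: One_nat_def)

lemma prod_5: "(\<Prod>j\<in>{1..5::nat}. f j) = f 1 * f 2 * f 3 * f 4 * f 5"
  by (simp add: numeral_eq_Suc mult_ac)

lemma esym_eq_esum: "esym a k = esum (\<lambda>j. (a j)\<^sup>2) {1..5} k"
  by (simp add: esym_def esum_def)

lemma sum_5: "(\<Sum>j\<in>{1..5::nat}. f j) = f 1 + f 2 + f 3 + f 4 + f 5"
  by (simp add: numeral_eq_Suc add_ac)

lemma prod_monic_linear_5:
  fixes q :: "nat \<Rightarrow> 'a::comm_ring_1"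
  shows "(\<Prod>j\<in>{1..5}. [:1, - q j:]) =
    [:1, - esum q {1..5} 1, esum q {1..5} 2, - esum q {1..5} 3, esum q {1..5} 4, - esum q {1..5} 5:]"
  by (simp add: prod_5 esum_5 algebra_simps del: One_nat_def)

text \<open>Because 1 + (b - 2) x + x^2 = (1 - x)^2 + b x, the product is the sum of all e_k x^k (1
  - x)^(10 - 2 k); this explains the signed binomial coefficients.\<close>

lemma prod_reciprocal_quadratic_5:
  fixes b :: "nat \<Rightarrow> 'a::comm_ring_1"
  defines "e \<equiv> esum b {1..5}"
  shows "(\<Prod>j\<in>{1..5}. [:1, b j - 2, 1:]) =
    [:1, e 1 - 10, e 2 - 8 * e 1 + 45, e 3 - 6 * e 2 + 28 * e 1 - 120,
      e 4 - 4 * e 3 + 15 * e 2 - 56 * e 1 + 210,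
      e 5 - 2 * e 4 + 6 * e 3 - 20 * e 2 + 70 * e 1 - 252,
      e 4 - 4 * e 3 + 15 * e 2 - 56 * e 1 + 210, e 3 - 6 * e 2 + 28 * e 1 - 120,
      e 2 - 8 * e 1 + 45, e 1 - 10, 1:]"
  by (simp add: prod_5 e_def esum_5 algebra_simps del: One_nat_def)

lemma prod_reversed_linear_5:
  fixes q :: "nat \<Rightarrow> 'a::comm_ring_1"
  shows "(\<Prod>j\<in>{1..5}. [:q j, -1:]) =
    [:esum q {1..5} 5, - esum q {1..5} 4, esum q {1..5} 3, - esum q {1..5} 2, esum q {1..5} 1, -1:]"
  by (simp add: prod_5 esum_5 algebra_simps del: One_nat_def)

text \<open>With \<open>p = 1 / q\<close> and \<open>b = 2 - q - p\<close> we have \<open>1 + (b - 2) x + x\<^sup>2 = (1 - q x) (1 - p x)\<close>. Taking the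
  product over \<open>j\<close> and comparing coefficients of \<open>x\<close> expresses the symmetric functions of the \<open>b\<^sub>j\<close> by
  those of the \<open>q\<^sub>j\<close>.\<close>

lemma esum_unimodular_5:
  fixes q p :: "nat \<Rightarrow> 'a::comm_ring_1"
  assumes qp: "\<forall>j\<in>{1..5}. q j * p j = 1"
    and prod: "esum q {1..5} 5 = 1"
  defines "s \<equiv> esum q {1..5}" and "e \<equiv> esum (\<lambda>j. 2 - q j - p j) {1..5}"
  shows "e 1 = 10 - s 1 - s 4"
    "e 2 = s 1 * s 4 - 8 * s 1 + s 2 + s 3 - 8 * s 4 + 35"
    "e 3 = - s 1 * s 3 + 6 * s 1 * s 4 - 20 * s 1 - s 2 * s 4 + 5 * s 2 + 5 * s 3 - 20 * s 4 + 50"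
    "e 4 = s 1 * s 2 - 4 * s 1 * s 3 + 9 * s 1 * s 4 - 15 * s 1 + s 2 * s 3 - 4 * s 2 * s 4
      + 5 * s 2 + s 3 * s 4 + 5 * s 3 - 15 * s 4 + 25"
    "e 5 = - (s 1 - s 2 + s 3 - s 4)\<^sup>2"
proof -
  let ?J = "{1..5::nat}"
  have "(\<Prod>j\<in>?J. [:q j:]) = [:esum q ?J 5:]"
    by (simp add: prod_5 esum_5 mult_ac del: One_nat_def)
  then have one: "(\<Prod>j\<in>?J. [:q j:]) = 1"
    by (simp add: prod one_pCons del: One_nat_def)
  have "(\<Prod>j\<in>?J. [:1, (2 - q j - p j) - 2, 1:]) = (\<Prod>j\<in>?J. [:1, - q j:] * [:1, - p j:])"
    using qp by (intro prod.cong) (auto simp: algebra_simps)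
  also have "\<dots> = (\<Prod>j\<in>?J. [:1, - q j:]) * (\<Prod>j\<in>?J. [:1, - p j:])"
    by (rule prod.distrib)
  \<comment> \<open>The constants q_j have product 1, so inserting them costs nothing and clears the
    inverses: q (1 - p x) = q - x.\<close>
  also have "(\<Prod>j\<in>?J. [:1, - p j:]) = (\<Prod>j\<in>?J. [:q j:]) * (\<Prod>j\<in>?J. [:1, - p j:])"
    by (simp only: one mult_1_left)
  also have "\<dots> = (\<Prod>j\<in>?J. [:q j:] * [:1, - p j:])"
    by (rule prod.distrib[symmetric])
  also have "\<dots> = (\<Prod>j\<in>?J. [:q j, -1:])"
    using qp by (intro prod.cong) (auto simp: algebra_simps)
  finally have c:
    "e 1 - 10 = - s 1 - s 4"
    "e 2 - 8 * e 1 + 45 = s 2 + s 1 * s 4 + s 3"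
    "e 3 - 6 * e 2 + 28 * e 1 - 120 = - s 3 - s 2 * s 4 - s 1 * s 3 - s 2"
    "e 4 - 4 * e 3 + 15 * e 2 - 56 * e 1 + 210 = s 4 + s 3 * s 4 + s 2 * s 3 + s 1 * s 2 + s 1"
    "e 5 - 2 * e 4 + 6 * e 3 - 20 * e 2 + 70 * e 1 - 252 =
      - 1 - s 4 * s 4 - s 3 * s 3 - s 2 * s 2 - s 1 * s 1 - 1"
    unfolding prod_reciprocal_quadratic_5 prod_monic_linear_5 prod_reversed_linear_5 prod
      s_def e_def
    by (simp_all add: algebra_simps del: One_nat_def)
  show 1: "e 1 = 10 - s 1 - s 4"
    using c(1) by (simp add: algebra_simps del: One_nat_def)
  \<comment> \<open>The coefficient equations are triangular in the \<open>e k\<close> and are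
    solved one after the other.\<close>
  have "e 2 = 8 * e 1 - 45 + (e 2 - 8 * e 1 + 45)" by simp
  then show 2: "e 2 = s 1 * s 4 - 8 * s 1 + s 2 + s 3 - 8 * s 4 + 35"
    unfolding c unfolding 1 by (simp add: algebra_simps del: One_nat_def)
  have "e 3 = 6 * e 2 - 28 * e 1 + 120 + (e 3 - 6 * e 2 + 28 * e 1 - 120)" by simp
  then show 3: "e 3 = - s 1 * s 3 + 6 * s 1 * s 4 - 20 * s 1 - s 2 * s 4 + 5 * s 2 + 5 * s 3 - 20 * s 4 + 50"
    unfolding c unfolding 1 2 by (simp add: algebra_simps del: One_nat_def)
  have "e 4 = 4 * e 3 - 15 * e 2 + 56 * e 1 - 210 + (e 4 - 4 * e 3 + 15 * e 2 - 56 * e 1 + 210)" by simp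
  then show 4: "e 4 = s 1 * s 2 - 4 * s 1 * s 3 + 9 * s 1 * s 4 - 15 * s 1 + s 2 * s 3 - 4 * s 2 * s 4
      + 5 * s 2 + s 3 * s 4 + 5 * s 3 - 15 * s 4 + 25"
    unfolding c unfolding 1 2 3 by (simp add: algebra_simps del: One_nat_def)
  have "e 5 = 2 * e 4 - 6 * e 3 + 20 * e 2 - 70 * e 1 + 252
      + (e 5 - 2 * e 4 + 6 * e 3 - 20 * e 2 + 70 * e 1 - 252)" by simp
  then show "e 5 = - (s 1 - s 2 + s 3 - s 4)\<^sup>2"
    unfolding c unfolding 1 2 3 4 by (simp add: algebra_simps power2_eq_square del: One_nat_def)
qed

text \<open>Up to powers of the scale \<open>D\<close>, the quantities \<open>u\<close>, \<open>t\<^sub>3\<close>, \<open>t\<^sub>4\<close>, \<open>t\<^sub>5\<close> depend only on \<open>s\<^sub>1 - s\<^sub>4\<close> and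
  \<open>s\<^sub>2 - s\<^sub>3\<close>, which reduces the relation to a short identity in two variables.\<close>

lemma robbins_relation:
  fixes q p :: "nat \<Rightarrow> 'a::comm_ring_1" and D u t2 t3 t4 t5 :: 'a and e :: "nat \<Rightarrow> 'a"
  assumes qp: "\<forall>j\<in>{1..5}. q j * p j = 1"
    and prod: "esum q {1..5} 5 = 1"
    and e_def: "e = esum (\<lambda>j. D * (2 - q j - p j)) {1..5}"
    and u_def: "u = - (D\<^sup>2 * (esum q {1..5} 1 - esum q {1..5} 4)\<^sup>2)"
    and t2_def: "t2 = (e 1)\<^sup>2 + u - 4 * e 2"
    and t3_def: "t3 = e 1 * t2 + 8 * e 3"
    and t4_def: "t4 = t2\<^sup>2 - 64 * e 4"
    and t5_def: "t5 = 128 * e 5"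
  shows "u * t4 ^ 3 + t3\<^sup>2 * t4\<^sup>2 - 16 * t3 ^ 3 * t5 - 18 * u * t3 * t4 * t5 - 27 * u\<^sup>2 * t5\<^sup>2 = 0"
proof -
  define s where "s = esum q {1..5}"
  define m where "m = s 1 - s 4"
  define n where "n = s 2 - s 3"
  have e: "e k = D ^ k * esum (\<lambda>j. 2 - q j - p j) {1..5} k" for k
    by (simp add: e_def esum_scale)
  note E = esum_unimodular_5[OF qp prod, folded s_def]
  have u: "u = - (D\<^sup>2 * m\<^sup>2)"
    by (simp add: u_def m_def s_def)
  have t2: "t2 = D\<^sup>2 * (12 * s 1 - 4 * s 2 - 4 * s 3 + 12 * s 4 - 40)"
    unfolding t2_def u m_def e E by (simp add: algebra_simps power2_eq_square eval_nat_numeral)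
  have t3: "t3 = D ^ 3 * (4 * m * (n - 3 * m))"
    unfolding t3_def t2 m_def n_def e E by (simp add: algebra_simps power2_eq_square eval_nat_numeral)
  have t4: "t4 = D ^ 4 * (16 * (m - n) * (9 * m - n))"
    unfolding t4_def t2 m_def n_def e E by (simp add: algebra_simps power2_eq_square eval_nat_numeral)
  have t5: "t5 = - (D ^ 5 * (128 * (m - n)\<^sup>2))"
    unfolding t5_def m_def n_def e E by (simp add: algebra_simps power2_eq_square eval_nat_numeral)
  \<comment> \<open>Every term carries \<open>D ^ 14\<close>; what remains is a polynomial identity
    in \<open>m\<close> and \<open>n\<close>.\<close>
  show ?thesis
    unfolding u t3 t4 t5 by (simp add: algebra_simps power2_eq_square eval_nat_numeral)
qed

lemma of_real_esum: "of_real (esum b I k) = esum (\<lambda>j. of_real (b j)) I k"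
  by (simp add: esum_def)

text \<open>The squared sides are R^2 (2 - q_j - 1/q_j) with q_j =
  \<open>cis (2 * \<theta> j)\<close>, and the q_j have product cis (2 \<pi>) = 1. So
  \<open>robbins_relation\<close> applies over the complex numbers. The root is 16 times the square
  of R^2/2 times the sum of the sin (2 \<theta>_j).\<close>

lemma robbins_root_cyclic:
  fixes a \<theta> :: "nat \<Rightarrow> real" and R :: real
  assumes sum: "(\<Sum>j\<in>{1..5}. \<theta> j) = pi"
    and a: "\<forall>j\<in>{1..5}. a j = 2 * R * sin (\<theta> j)"
  shows "poly (robbins_poly a) (4 * R ^ 4 * (\<Sum>j\<in>{1..5}. sin (2 * \<theta> j))\<^sup>2) = 0"
proof -
  let ?J = "{1..5::nat}"
  define q where "q j = cis (2 * \<theta> j)" for j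
  define p where "p j = cis (- (2 * \<theta> j))" for j
  define s where "s = esum q ?J"
  define D where "D = complex_of_real (R\<^sup>2)"
  define e where "e = esum (\<lambda>j. D * (2 - q j - p j)) ?J"
  have qp: "\<forall>j\<in>?J. q j * p j = 1"
    by (simp add: q_def p_def cis_mult)
  have "s 5 = (\<Prod>j\<in>?J. q j)"
    by (simp only: s_def esum_5 prod_5)
  also have "\<dots> = cis (2 * (\<Sum>j\<in>?J. \<theta> j))"
    by (simp only: prod_5 sum_5 q_def cis_mult distrib_left)
  finally have prod: "esum q ?J 5 = 1"
    using sum by (simp add: s_def cis.ctr complex_eq_iff)
  have "complex_of_real ((a j)\<^sup>2) = D * (2 - q j - p j)" if "j \<in> ?J" for j
  proof -
    have "(a j)\<^sup>2 = R\<^sup>2 * (2 * (2 * (sin (\<theta> j))\<^sup>2))"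
      using a that by (simp add: power_mult_distrib)
    also have "2 * (sin (\<theta> j))\<^sup>2 = 1 - cos (2 * \<theta> j)"
      by (simp add: cos_double_sin)
    finally show ?thesis
      by (simp add: D_def q_def p_def complex_eq_iff)
  qed
  then have esym: "complex_of_real (esym a k) = e k" for k
    unfolding esym_eq_esum of_real_esum e_def
    unfolding esum_def by (intro sum.cong prod.cong) auto
  \<comment> \<open>Compare \<open>e 1\<close> = 10 - s_1 - s_4 with its expansion as the sum of all
    2 - q_j - p_j.\<close>
  have "s 4 = (\<Sum>j\<in>?J. p j)"
    using esum_unimodular_5(1)[OF qp prod] unfolding s_def esum_5
    by (simp add: sum_5 algebra_simps del: One_nat_def)
  then have "s 1 - s 4 = (\<Sum>j\<in>?J. q j - p j)"
    by (simp add: s_def esum_5 sum_5 sum_subtractf del: One_nat_def)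
  also have "\<dots> = (\<Sum>j\<in>?J. 2 * \<i> * complex_of_real (sin (2 * \<theta> j)))"
    by (intro sum.cong) (auto simp: q_def p_def complex_eq_iff)
  also have "\<dots> = 2 * \<i> * complex_of_real (\<Sum>j\<in>?J. sin (2 * \<theta> j))"
    by (simp add: sum_distrib_left)
  finally have u: "complex_of_real (4 * R ^ 4 * (\<Sum>j\<in>?J. sin (2 * \<theta> j))\<^sup>2) = - (D\<^sup>2 * (s 1 - s 4)\<^sup>2)"
    by (simp add: D_def power_mult_distrib)
  define u where "u = 4 * R ^ 4 * (\<Sum>j\<in>?J. sin (2 * \<theta> j))\<^sup>2"
  define t2 where "t2 = (esym a 1)\<^sup>2 + u - 4 * esym a 2"
  define t3 where "t3 = esym a 1 * t2 + 8 * esym a 3"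
  define t4 where "t4 = t2\<^sup>2 - 64 * esym a 4"
  define t5 where "t5 = 128 * esym a 5"
  note of_real = of_real_add of_real_diff of_real_mult of_real_power of_real_numeral
  have "complex_of_real (u * t4 ^ 3 + t3\<^sup>2 * t4\<^sup>2 - 16 * t3 ^ 3 * t5 - 18 * u * t3 * t4 * t5
      - 27 * u\<^sup>2 * t5\<^sup>2) = 0"
    unfolding of_real
  proof (rule robbins_relation[OF qp prod])
    show "e = esum (\<lambda>j. D * (2 - q j - p j)) {1..5}"
      by (simp only: e_def)
    show "complex_of_real u = - (D\<^sup>2 * (esum q {1..5} 1 - esum q {1..5} 4)\<^sup>2)"
      using u by (simp only: u_def s_def)
    show "complex_of_real t2 = (e 1)\<^sup>2 + complex_of_real u - 4 * e 2"
      by (simp only: t2_def of_real esym)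
    show "complex_of_real t3 = e 1 * complex_of_real t2 + 8 * e 3"
      by (simp only: t3_def of_real esym)
    show "complex_of_real t4 = (complex_of_real t2)\<^sup>2 - 64 * e 4"
      by (simp only: t4_def of_real esym)
    show "complex_of_real t5 = 128 * e 5"
      by (simp only: t5_def of_real esym)
  qed
  then show ?thesis
    unfolding of_real_eq_0_iff poly_robbins_poly Let_def u_def[symmetric] t2_def[symmetric]
      t3_def[symmetric] t4_def[symmetric] t5_def[symmetric] .
qed

section \<open>Maximal area of a pentagon with given sides\<close>

text \<open>Here \<open>d\<close>, \<open>w\<close>, \<open>-(d + w)\<close> are the side vectors of one triangle and \<open>\<alpha>\<close>, \<open>\<beta>\<close>, \<open>\<pi> - \<alpha> - \<beta>\<close>
  the angles of another one; the right-hand side measures how far the two are from being similar.\<close>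

lemma neuberg_pedoe_identity:
  fixes d w :: complex
  assumes "sin \<alpha> \<noteq> 0" "sin \<beta> \<noteq> 0" "sin (\<alpha> + \<beta>) \<noteq> 0"
  shows "cot \<alpha> * (cmod d)\<^sup>2 + cot \<beta> * (cmod w)\<^sup>2 - cot (\<alpha> + \<beta>) * (cmod (d + w))\<^sup>2
      - 2 * Im (cnj d * w) =
    (cmod (of_real (sin \<beta>) * cis (\<alpha> + \<beta>) * d - of_real (sin \<alpha>) * w))\<^sup>2
      / (sin \<alpha> * sin \<beta> * sin (\<alpha> + \<beta>))"
proof -
  define \<gamma> where "\<gamma> = \<alpha> + \<beta>"
  have 1: "sin \<gamma> * cos \<alpha> - cos \<gamma> * sin \<alpha> = sin \<beta>"
    using sin_diff[of \<gamma> \<alpha>] by (simp add: \<gamma>_def)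
  have 2: "sin \<gamma> * cos \<beta> - cos \<gamma> * sin \<beta> = sin \<alpha>"
    using sin_diff[of \<gamma> \<beta>] by (simp add: \<gamma>_def)
  have 3: "(sin \<gamma>)\<^sup>2 + (cos \<gamma>)\<^sup>2 = 1"
    by simp
  obtain x y z t where d: "d = Complex x y" and w: "w = Complex z t"
    by (cases d, cases w) auto
  have n: "(cmod (of_real (sin \<beta>) * cis \<gamma> * d - of_real (sin \<alpha>) * w))\<^sup>2 =
      (sin \<beta>)\<^sup>2 * (x\<^sup>2 + y\<^sup>2) + (sin \<alpha>)\<^sup>2 * (z\<^sup>2 + t\<^sup>2)
        - 2 * sin \<alpha> * sin \<beta> * (cos \<gamma> * (x * z + y * t) + sin \<gamma> * (x * t - y * z))"
  proof -
    have "(cmod (of_real (sin \<beta>) * cis \<gamma> * d - of_real (sin \<alpha>) * w))\<^sup>2 =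
        (sin \<beta> * cos \<gamma> * x - sin \<beta> * sin \<gamma> * y - sin \<alpha> * z)\<^sup>2 +
        (sin \<beta> * cos \<gamma> * y + sin \<beta> * sin \<gamma> * x - sin \<alpha> * t)\<^sup>2"
      by (simp add: cmod_power2 d w)
    with 3 show ?thesis
      by algebra
  qed
  have c: "sin \<alpha> * sin \<beta> * sin \<gamma> * (cot \<alpha> * (cmod d)\<^sup>2 + cot \<beta> * (cmod w)\<^sup>2
        - cot \<gamma> * (cmod (d + w))\<^sup>2 - 2 * Im (cnj d * w)) =
      cos \<alpha> * sin \<beta> * sin \<gamma> * (x\<^sup>2 + y\<^sup>2) + sin \<alpha> * cos \<beta> * sin \<gamma> * (z\<^sup>2 + t\<^sup>2)
        - sin \<alpha> * sin \<beta> * cos \<gamma> * ((x + z)\<^sup>2 + (y + t)\<^sup>2)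
        - 2 * sin \<alpha> * sin \<beta> * sin \<gamma> * (x * t - y * z)"
    using assms[folded \<gamma>_def] unfolding cmod_power2 d w cot_def by (simp add: field_simps)
  have "cos \<alpha> * sin \<beta> * sin \<gamma> * (x\<^sup>2 + y\<^sup>2) + sin \<alpha> * cos \<beta> * sin \<gamma> * (z\<^sup>2 + t\<^sup>2)
        - sin \<alpha> * sin \<beta> * cos \<gamma> * ((x + z)\<^sup>2 + (y + t)\<^sup>2)
        - 2 * sin \<alpha> * sin \<beta> * sin \<gamma> * (x * t - y * z) =
      (sin \<beta>)\<^sup>2 * (x\<^sup>2 + y\<^sup>2) + (sin \<alpha>)\<^sup>2 * (z\<^sup>2 + t\<^sup>2)
        - 2 * sin \<alpha> * sin \<beta> * (cos \<gamma> * (x * z + y * t) + sin \<gamma> * (x * t - y * z))"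
  proof -
    \<comment> \<open>Expanding |d + w|^2 moves its square terms into the coefficients of |d|^2 and
      |w|^2, which 1 and 2 then turn into squares of sines.\<close>
    have "cos \<alpha> * sin \<beta> * sin \<gamma> * (x\<^sup>2 + y\<^sup>2) + sin \<alpha> * cos \<beta> * sin \<gamma> * (z\<^sup>2 + t\<^sup>2)
        - sin \<alpha> * sin \<beta> * cos \<gamma> * ((x + z)\<^sup>2 + (y + t)\<^sup>2)
        - 2 * sin \<alpha> * sin \<beta> * sin \<gamma> * (x * t - y * z) =
      sin \<beta> * (sin \<gamma> * cos \<alpha> - cos \<gamma> * sin \<alpha>) * (x\<^sup>2 + y\<^sup>2)
        + sin \<alpha> * (sin \<gamma> * cos \<beta> - cos \<gamma> * sin \<beta>) * (z\<^sup>2 + t\<^sup>2)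
        - 2 * sin \<alpha> * sin \<beta> * (cos \<gamma> * (x * z + y * t) + sin \<gamma> * (x * t - y * z))"
      by (simp add: algebra_simps power2_eq_square)
    then show ?thesis
      unfolding 1 2 by (simp add: power2_eq_square)
  qed
  with n c have "sin \<alpha> * sin \<beta> * sin \<gamma> * (cot \<alpha> * (cmod d)\<^sup>2 + cot \<beta> * (cmod w)\<^sup>2
        - cot \<gamma> * (cmod (d + w))\<^sup>2 - 2 * Im (cnj d * w)) =
      (cmod (of_real (sin \<beta>) * cis \<gamma> * d - of_real (sin \<alpha>) * w))\<^sup>2"
    by (simp only:)
  moreover have "sin \<alpha> * sin \<beta> * sin \<gamma> \<noteq> 0"
    using assms by (simp add: \<gamma>_def)
  ultimately show ?thesis
    unfolding \<gamma>_def by (metis nonzero_mult_div_cancel_left)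
qed

text \<open>In the equality case the square in \<open>neuberg_pedoe_identity\<close> vanishes, so
  \<open>d\<close> determines \<open>w\<close>. The form \<rho> (cis - 1) puts the vertices on a
  circle of radius |\<rho>| through the apex; since \<rho> is the same in premise and conclusion,
  the triangles of a fan can be chained along one circle.\<close>

lemma neuberg_pedoe:
  fixes d w :: complex
  assumes "0 < \<alpha>" "0 < \<beta>" "\<alpha> + \<beta> < pi"
  shows "2 * Im (cnj d * w) \<le>
      cot \<alpha> * (cmod d)\<^sup>2 + cot \<beta> * (cmod w)\<^sup>2 - cot (\<alpha> + \<beta>) * (cmod (d + w))\<^sup>2"
    and "2 * Im (cnj d * w) =
      cot \<alpha> * (cmod d)\<^sup>2 + cot \<beta> * (cmod w)\<^sup>2 - cot (\<alpha> + \<beta>) * (cmod (d + w))\<^sup>2 \<Longrightarrow>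
      d = \<rho> * (cis (2 * \<alpha>) - 1) \<Longrightarrow> d + w = \<rho> * (cis (2 * (\<alpha> + \<beta>)) - 1)"
proof -
  have s: "sin \<alpha> > 0" "sin \<beta> > 0" "sin (\<alpha> + \<beta>) > 0"
    using assms by (auto intro!: sin_gt_zero)
  note id = neuberg_pedoe_identity[of \<alpha> \<beta> d w]
  have "0 \<le> (cmod (of_real (sin \<beta>) * cis (\<alpha> + \<beta>) * d - of_real (sin \<alpha>) * w))\<^sup>2
      / (sin \<alpha> * sin \<beta> * sin (\<alpha> + \<beta>))"
    using s by simp
  with id s show "2 * Im (cnj d * w) \<le>
      cot \<alpha> * (cmod d)\<^sup>2 + cot \<beta> * (cmod w)\<^sup>2 - cot (\<alpha> + \<beta>) * (cmod (d + w))\<^sup>2"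
    by linarith
  assume eq: "2 * Im (cnj d * w) =
      cot \<alpha> * (cmod d)\<^sup>2 + cot \<beta> * (cmod w)\<^sup>2 - cot (\<alpha> + \<beta>) * (cmod (d + w))\<^sup>2"
    and d: "d = \<rho> * (cis (2 * \<alpha>) - 1)"
  have chord: "cis (2 * x) - 1 = 2 * \<i> * of_real (sin x) * cis x" for x
    using cos_double_sin[of x] sin_double[of x] by (simp add: complex_eq_iff power2_eq_square)
  from eq id s have "of_real (sin \<alpha>) * w = of_real (sin \<beta>) * cis (\<alpha> + \<beta>) * d"
    by simp
  also have "\<dots> = of_real (sin \<alpha>) * (\<rho> * (cis (2 * \<alpha>) * (cis (2 * \<beta>) - 1)))"
  proof -
    have "cis (2 * \<alpha>) = cis \<alpha> * cis \<alpha>" "cis (\<alpha> + \<beta>) = cis \<alpha> * cis \<beta>"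
      by (simp_all add: cis_mult)
    then show ?thesis
      unfolding d chord by (simp only: mult_ac)
  qed
  finally have "w = \<rho> * (cis (2 * \<alpha>) * (cis (2 * \<beta>) - 1))"
    using s by simp
  moreover have "cis (2 * (\<alpha> + \<beta>)) = cis (2 * \<alpha>) * cis (2 * \<beta>)"
    by (simp add: cis_mult distrib_left)
  ultimately show "d + w = \<rho> * (cis (2 * (\<alpha> + \<beta>)) - 1)"
    unfolding d by (simp add: algebra_simps)
qed

text \<open>The signed area, as the sum over the fan of triangles with apex \<open>V 1\<close>.\<close>

definition shoelace :: "(nat \<Rightarrow> complex) \<Rightarrow> real" where
  "shoelace V = (Im (cnj (V 2 - V 1) * (V 3 - V 2)) + Im (cnj (V 3 - V 1) * (V 4 - V 3))
     + Im (cnj (V 4 - V 1) * (V 5 - V 4))) / 2"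

lemma shoelace_bound:
  fixes V :: "nat \<Rightarrow> complex" and \<theta> :: "nat \<Rightarrow> real"
  assumes pos: "\<forall>j\<in>{1..5}. 0 < \<theta> j" and sum: "(\<Sum>j\<in>{1..5}. \<theta> j) = pi"
    and conf: "configuration a V"
  defines "M \<equiv> (\<Sum>j\<in>{1..5}. cot (\<theta> j) * (a j)\<^sup>2) / 4"
  shows "shoelace V \<le> M"
    and "shoelace V = M \<Longrightarrow> V 1 \<noteq> V 2 \<Longrightarrow> chordal V"
proof -
  have th: "0 < \<theta> 1" "0 < \<theta> 2" "0 < \<theta> 3" "0 < \<theta> 4" "0 < \<theta> 5"
    "\<theta> 5 = pi - (\<theta> 1 + \<theta> 2 + \<theta> 3 + \<theta> 4)"
    using pos sum by (simp_all add: sum_5 del: One_nat_def)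
  have a: "cmod (V 2 - V 1) = a 1" "cmod (V 3 - V 2) = a 2" "cmod (V 4 - V 3) = a 3"
    "cmod (V 5 - V 4) = a 4" "cmod (V 5 - V 1) = a 5"
  proof -
    have d: "dist (V j) (V (nxt j)) = a j" if "j \<in> {1..5}" for j
      using conf that by (simp add: configuration_def)
    have "nxt 1 = 2" "nxt 2 = 3" "nxt 3 = 4" "nxt 4 = 5" "nxt 5 = 1"
      by (simp_all add: nxt_def)
    with d[of 1] d[of 2] d[of 3] d[of 4] d[of 5] show "cmod (V 2 - V 1) = a 1"
      "cmod (V 3 - V 2) = a 2" "cmod (V 4 - V 3) = a 3" "cmod (V 5 - V 4) = a 4"
      "cmod (V 5 - V 1) = a 5"
      by (simp_all add: dist_norm norm_minus_commute)
  qed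
  \<comment> \<open>This makes the last term of the last triangle the contribution of the fifth side
    to \<open>M\<close>.\<close>
  have cot5: "cot (\<theta> 5) = - cot (\<theta> 1 + \<theta> 2 + \<theta> 3 + \<theta> 4)"
    unfolding th(6) by (simp add: cot_def)
  have M: "4 * M = cot (\<theta> 1) * (a 1)\<^sup>2 + cot (\<theta> 2) * (a 2)\<^sup>2 + cot (\<theta> 3) * (a 3)\<^sup>2
      + cot (\<theta> 4) * (a 4)\<^sup>2 - cot (\<theta> 1 + \<theta> 2 + \<theta> 3 + \<theta> 4) * (a 5)\<^sup>2"
    by (simp add: M_def sum_5 cot5 del: One_nat_def)
  define n3 n4 where "n3 = (cmod (V 3 - V 1))\<^sup>2" and "n4 = (cmod (V 4 - V 1))\<^sup>2"
  define T1 T2 T3 where "T1 = Im (cnj (V 2 - V 1) * (V 3 - V 2))"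
    and "T2 = Im (cnj (V 3 - V 1) * (V 4 - V 3))" and "T3 = Im (cnj (V 4 - V 1) * (V 5 - V 4))"
  define B1 B2 B3 where "B1 = cot (\<theta> 1) * (a 1)\<^sup>2 + cot (\<theta> 2) * (a 2)\<^sup>2 - cot (\<theta> 1 + \<theta> 2) * n3"
    and "B2 = cot (\<theta> 1 + \<theta> 2) * n3 + cot (\<theta> 3) * (a 3)\<^sup>2 - cot (\<theta> 1 + \<theta> 2 + \<theta> 3) * n4"
    and "B3 = cot (\<theta> 1 + \<theta> 2 + \<theta> 3) * n4 + cot (\<theta> 4) * (a 4)\<^sup>2
      - cot (\<theta> 1 + \<theta> 2 + \<theta> 3 + \<theta> 4) * (a 5)\<^sup>2"
  have chain: "(y - x) + (z - y) = z - x" for x y z :: complex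
    by simp
  have lt: "\<theta> 1 + \<theta> 2 < pi" "\<theta> 1 + \<theta> 2 + \<theta> 3 < pi" "\<theta> 1 + \<theta> 2 + \<theta> 3 + \<theta> 4 < pi"
    "0 < \<theta> 1 + \<theta> 2" "0 < \<theta> 1 + \<theta> 2 + \<theta> 3"
    using th by linarith+
  note P1 = neuberg_pedoe[OF th(1,2) lt(1), where d = "V 2 - V 1" and w = "V 3 - V 2",
      unfolded chain, unfolded a, folded n3_def T1_def, folded B1_def]
  note P2 = neuberg_pedoe[OF lt(4) th(3) lt(2), where d = "V 3 - V 1" and w = "V 4 - V 3",
      unfolded chain, unfolded a, folded n3_def n4_def T2_def, folded B2_def]
  note P3 = neuberg_pedoe[OF lt(5) th(4) lt(3), where d = "V 4 - V 1" and w = "V 5 - V 4",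
      unfolded chain, unfolded a, folded n4_def T3_def, folded B3_def]
  have S: "2 * shoelace V = T1 + T2 + T3"
    by (simp add: shoelace_def T1_def T2_def T3_def)
  have MB: "4 * M = B1 + B2 + B3"
    by (simp add: M B1_def B2_def B3_def)
  show "shoelace V \<le> M"
    using P1(1) P2(1) P3(1) S MB by argo
  assume eq: "shoelace V = M" and ne: "V 1 \<noteq> V 2"
  then have E: "2 * T1 = B1" "2 * T2 = B2" "2 * T3 = B3"
    using P1(1) P2(1) P3(1) S MB by argo+
  have "cos (2 * \<theta> 1) \<noteq> 1"
    using sin_gt_zero[of "\<theta> 1"] th(1) lt(1) th(2) cos_double_sin[of "\<theta> 1"] by simp
  then have "cis (2 * \<theta> 1) - 1 \<noteq> 0"
    by (metis cis.sel(1) eq_iff_diff_eq_0 one_complex.sel(1))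
  \<comment> \<open>The first side fixes the circle: its centre is \<open>V 1 - \<rho>\<close>, and
    turning \<open>V 1\<close> about it by 2 \<theta>_1 gives \<open>V 2\<close>.\<close>
  then obtain \<rho> where \<rho>: "V 2 - V 1 = \<rho> * (cis (2 * \<theta> 1) - 1)"
    by (metis nonzero_eq_divide_eq)
  with ne have "\<rho> \<noteq> 0"
    by auto
  note 3 = P1(2)[OF E(1) \<rho>]
  note 4 = P2(2)[OF E(2) 3]
  note 5 = P3(2)[OF E(3) 4]
  have on: "z \<in> sphere (V 1 - \<rho>) (cmod \<rho>)" if "z - V 1 = \<rho> * (cis \<phi> - 1)" for z \<phi>
  proof -
    have "z - (V 1 - \<rho>) = \<rho> * cis \<phi>"
      using that by (simp add: algebra_simps)
    then show ?thesis
      by (metis dist_commute dist_norm mem_sphere mult.right_neutral norm_cis norm_mult)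
  qed
  have "V 1 \<in> sphere (V 1 - \<rho>) (cmod \<rho>)"
    by (simp add: dist_norm)
  with \<rho> 3 4 5 on have "\<forall>j\<in>{1, 2, 3, 4, 5}. V j \<in> sphere (V 1 - \<rho>) (cmod \<rho>)"
    by blast
  then show "chordal V"
    using \<open>\<rho> \<noteq> 0\<close> unfolding chordal_def atLeastAtMost_1_5 by (metis zero_less_norm_iff)
qed

section \<open>Existence of a cyclic pentagon\<close>

text \<open>With \<open>t = 1 / (2 R)\<close> the angles are \<open>arcsin (a\<^sub>j t)\<close> if the circle's centre lies inside the polygon;
  otherwise the longest side \<open>m\<close> has the angle \<open>\<pi> - arcsin (a\<^sub>m t)\<close>. Which case occurs is decided by the
  smallest admissible radius, where \<open>a\<^sub>m\<close> is a diameter.\<close>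

lemma cyclic_angles_exist:
  fixes a :: "'i \<Rightarrow> real"
  assumes fin: "finite I" and pos: "\<forall>j\<in>I. a j > 0"
    and m: "m \<in> I" "\<forall>j\<in>I. a j \<le> a m" "a m < sum a (I - {m})"
  obtains \<theta> R where "\<forall>j\<in>I. 0 < \<theta> j" "sum \<theta> I = pi" "\<forall>j\<in>I. a j = 2 * R * sin (\<theta> j)"
proof -
  let ?J = "I - {m}"
  have M: "a m > 0"
    using pos m by auto
  define f where "f t = (\<Sum>j\<in>?J. arcsin (a j * t))" for t
  have range: "-1 \<le> a j * t" "a j * t \<le> 1" if "j \<in> I" "t \<in> {0..1 / a m}" for j t
  proof -
    have "0 \<le> a j * t"
      using that pos by (simp add: less_imp_le)
    moreover have "a j * t \<le> a m * (1 / a m)"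
      using that m pos M by (intro mult_mono) (auto simp: less_imp_le)
    ultimately show "-1 \<le> a j * t" "a j * t \<le> 1"
      using M by auto
  qed
  have contf: "continuous_on {0..1 / a m} f"
    unfolding f_def using range by (intro continuous_intros) auto
  have contm: "continuous_on {0..1 / a m} (\<lambda>t. arcsin (a m * t))"
    using range m by (intro continuous_intros) auto
  have split: "sum g I = g m + sum g ?J" for g :: "'i \<Rightarrow> real"
    using fin m by (simp add: sum.remove)
  have arcsin_pos: "0 < arcsin (a j * t)" "sin (arcsin (a j * t)) = a j * t"
    if "j \<in> I" "0 < t" "t \<le> 1 / a m" for j t
    using arcsin_less_mono[of 0 "a j * t"] range[of j t] that pos by auto
  show ?thesis
  proof (cases "f (1 / a m) \<ge> pi / 2")
    case True
    \<comment> \<open>The angle sum is 0 at t = 0 and at least \<pi>/2 + \<pi>/2 at the right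
      end.\<close>
    have "\<exists>t\<ge>0. t \<le> 1 / a m \<and> f t + arcsin (a m * t) = pi"
      using True M contf contm by (intro IVT') (auto simp: f_def intro!: continuous_intros)
    then obtain t where t: "0 \<le> t" "t \<le> 1 / a m" "f t + arcsin (a m * t) = pi"
      by blast
    then have "0 < t"
      by (cases "t = 0") (auto simp: f_def)
    show ?thesis
    proof (rule that[of "\<lambda>j. arcsin (a j * t)" "1 / (2 * t)"])
      show "(\<Sum>j\<in>I. arcsin (a j * t)) = pi"
        using t(3) by (simp add: split f_def)
    qed (use arcsin_pos \<open>0 < t\<close> t(2) in auto)
  next
    case False
    \<comment> \<open>The angles sum to \<pi> iff \<open>h\<close> vanishes. The trivial zero t = 0
      must be avoided: by the polygon inequality \<open>h\<close> has positive slope there, so it is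
      positive at a small \<open>t0\<close>, while it is negative at the right end.\<close>
    define h where "h t = f t - arcsin (a m * t)" for t
    have "(h has_real_derivative (\<Sum>j\<in>?J. a j) - a m) (at 0)"
      unfolding h_def f_def by (auto intro!: derivative_eq_intros)
    then obtain d where d: "d > 0" "\<And>k. 0 < k \<Longrightarrow> k < d \<Longrightarrow> h 0 < h (0 + k)"
      using DERIV_pos_inc_right[of h _ 0] m(3) by force
    define t0 where "t0 = min (d / 2) (1 / a m)"
    have t0: "0 < t0" "t0 \<le> 1 / a m" "t0 < d"
      using d(1) M by (auto simp: t0_def)
    then have "h t0 > 0"
      using d(2)[of t0] by (simp add: h_def f_def)
    moreover have "h (1 / a m) < 0"
      using False M by (simp add: h_def)
    moreover have "continuous_on {t0..1 / a m} h"
      unfolding h_def using t0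
      by (intro continuous_on_subset[OF continuous_on_diff[OF contf contm]]) auto
    ultimately have "\<exists>t\<ge>t0. t \<le> 1 / a m \<and> h t = 0"
      using t0 by (intro IVT2') auto
    then obtain t where "t0 \<le> t" and t: "t \<le> 1 / a m" "h t = 0"
      by blast
    then have "0 < t"
      using t0(1) by simp
    define \<theta> where "\<theta> j = (if j = m then pi - arcsin (a m * t) else arcsin (a j * t))" for j
    note t = \<open>0 < t\<close> t
    have "sum \<theta> ?J = f t"
      unfolding f_def by (rule sum.cong) (auto simp: \<theta>_def)
    then have "sum \<theta> I = pi"
      using t(3) by (simp add: split h_def \<theta>_def)
    moreover have "0 < \<theta> j" "a j = 2 * (1 / (2 * t)) * sin (\<theta> j)" if "j \<in> I" for j
      using arcsin_pos[of j t] t that m arcsin_bounded[of "a m * t"] range[of m t] pi_gt_zero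
      by (auto simp: \<theta>_def)
    ultimately show ?thesis
      by (intro that[of \<theta> "1 / (2 * t)"]) auto
  qed
qed

section \<open>The strict polygon inequality for simple pentagons\<close>

text \<open>Each vertex splits the path from \<open>q\<close> back to \<open>p\<close> into two
  parts that are together no longer than \<open>dist p q\<close>, which forces equality in the
  triangle inequality.\<close>

lemma long_side_closed_segment:
  fixes p q r s t :: "'a::euclidean_space"
  assumes "dist q r + dist r s + dist s t + dist t p \<le> dist p q"
  shows "{p, q, r, s, t} \<subseteq> closed_segment p q"
proof -
  have "x \<in> closed_segment p q" if "dist p x + dist x q \<le> dist p q" for x
    using that dist_triangle[of p q x] unfolding between_mem_segment[symmetric] between by auto
  moreover have "dist p r + dist r q \<le> dist p q" "dist p s + dist s q \<le> dist p q"
    "dist p t + dist t q \<le> dist p q"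
    using assms dist_triangle[of r p s] dist_triangle[of s p t] dist_triangle[of q s r]
      dist_triangle[of q t s]
    by (simp_all add: dist_commute)
  ultimately show ?thesis
    by simp
qed

lemma path_pentagon_path: "path (pentagon_path V)" "pathfinish (pentagon_path V) = pathstart (pentagon_path V)"
  by (simp_all add: pentagon_path_def)

lemma path_image_pentagon_path:
  "path_image (pentagon_path V) = closed_segment (V 1) (V 2) \<union> closed_segment (V 2) (V 3) \<union>
     closed_segment (V 3) (V 4) \<union> closed_segment (V 4) (V 5) \<union> closed_segment (V 5) (V 1)"
  by (simp add: pentagon_path_def path_image_join Un_assoc)

text \<open>The complement of a convex set containing the curve lies outside the curve, so the
  inside would be part of the segment. By the Jordan curve theorem it is open and nonempty, but a
  segment has empty interior in the plane.\<close>

lemma simple_pentagon_not_in_segment: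
  assumes simple: "simple_path (pentagon_path V)"
  shows "\<not> V ` {1..5} \<subseteq> closed_segment p q"
proof
  assume "V ` {1..5} \<subseteq> closed_segment p q"
  then have "V j \<in> closed_segment p q" if "j \<in> {1..5}" for j
    using that by blast
  then have "path_image (pentagon_path V) \<subseteq> closed_segment p q"
    unfolding path_image_pentagon_path
    by (intro Un_least closed_segment_subset convex_closed_segment) auto
  then have "- closed_segment p q \<subseteq> outside (path_image (pentagon_path V))"
    by (intro outside_subset_convex convex_closed_segment)
  then have "inside (path_image (pentagon_path V)) \<subseteq> closed_segment p q"
    using inside_Int_outside[of "path_image (pentagon_path V)"] by blast
  moreover have "open (inside (path_image (pentagon_path V)))"
    "inside (path_image (pentagon_path V)) \<noteq> {}"
    using Jordan_inside_outside[OF simple path_pentagon_path(2)] by auto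
  ultimately have "interior (closed_segment p q) \<noteq> {}"
    using interior_maximal by blast
  then show False
    by (simp add: interior_closed_segment_ge2)
qed

text \<open>Supplies the inequality assumed in \<open>cyclic_angles_exist\<close>: a side at least
  as long as the others together would flatten the pentagon onto itself.\<close>

lemma simple_pentagon_side_less:
  assumes simple: "simple_path (pentagon_path V)" and conf: "configuration a V" and m: "m \<in> {1..5}"
  shows "a m < sum a ({1..5} - {m})"
proof (rule ccontr)
  assume "\<not> ?thesis"
  then have long: "sum a ({1..5} - {m}) \<le> a m"
    by simp
  have d: "dist (V j) (V (nxt j)) = a j" if "j \<in> {1..5}" for j
    using conf that by (simp add: configuration_def)
  have n: "nxt 1 = 2" "nxt 2 = 3" "nxt 3 = 4" "nxt 4 = 5" "nxt 5 = 1"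
    by (simp_all add: nxt_def)
  have a: "a 1 = dist (V 1) (V 2)" "a 2 = dist (V 2) (V 3)" "a 3 = dist (V 3) (V 4)"
    "a 4 = dist (V 4) (V 5)" "a 5 = dist (V 5) (V 1)"
    using d[of 1] d[of 2] d[of 3] d[of 4] d[of 5] unfolding n by auto
  have "sum a {1..5} - a m \<le> a m"
    using long m by (simp add: sum.remove)
  then have s: "a 1 + a 2 + a 3 + a 4 + a 5 \<le> 2 * a m"
    by (simp add: sum_5 del: One_nat_def)
  have key: "\<exists>p q. V ` {1..5} \<subseteq> closed_segment p q"
    if "{1..5} = {i, j, k, l, n}" "dist (V j) (V k) + dist (V k) (V l) + dist (V l) (V n)
      + dist (V n) (V i) \<le> dist (V i) (V j)" for i j k l n
    using long_side_closed_segment[OF that(2)] unfolding that(1) image_insert image_empty by blast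
  have "m = 1 \<or> m = 2 \<or> m = 3 \<or> m = 4 \<or> m = 5"
    using m unfolding atLeastAtMost_1_5 by simp
  then have "\<exists>p q. V ` {1..5} \<subseteq> closed_segment p q"
  proof (elim disjE)
    assume "m = 1"
    show ?thesis
      by (rule key[of 1 2 3 4 5]) (use s \<open>m = 1\<close> a in auto)
  next
    assume "m = 2"
    show ?thesis
      by (rule key[of 2 3 4 5 1]) (use s \<open>m = 2\<close> a in auto)
  next
    assume "m = 3"
    show ?thesis
      by (rule key[of 3 4 5 1 2]) (use s \<open>m = 3\<close> a in auto)
  next
    assume "m = 4"
    show ?thesis
      by (rule key[of 4 5 1 2 3]) (use s \<open>m = 4\<close> a in auto)
  next
    assume "m = 5"
    show ?thesis
      by (rule key[of 5 1 2 3 4]) (use s \<open>m = 5\<close> a in auto)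
  qed
  with simple_pentagon_not_in_segment[OF simple] show False
    by blast
qed

section \<open>Area of a simple pentagon\<close>

text \<open>Carries \<open>content_triangle\<close>, a formula in \<open>real^2\<close>, over to the
  complex plane; it suffices to compare the measures of boxes.\<close>

lemma distr_lborel_real2_complex:
  "distr lborel borel (\<lambda>v :: real^2. Complex (v $ 1) (v $ 2)) = lborel"
proof (rule lborel_eqI[symmetric])
  let ?f = "\<lambda>v :: real^2. Complex (v $ 1) (v $ 2)"
  have meas: "?f \<in> borel_measurable borel"
    by (intro borel_measurable_continuous_onI) (auto simp: complex_eq intro!: continuous_intros)
  fix l u :: complex
  assume le: "\<And>b. b \<in> Basis \<Longrightarrow> l \<bullet> b \<le> u \<bullet> b"
  define l' u' :: "real^2" where "l' = vector [Re l, Im l]" and "u' = vector [Re u, Im u]"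
  have "Re l \<le> Re u" "Im l \<le> Im u"
    using le[of 1] le[of \<i>] by (auto simp: Basis_complex_def)
  then have "\<forall>i. l' $ i \<le> u' $ i"
    by (simp add: l'_def u'_def forall_2)
  then have le': "\<And>b. b \<in> Basis \<Longrightarrow> l' \<bullet> b \<le> u' \<bullet> b"
    by (auto simp: Basis_vec_def inner_axis)
  have "?f -` box l u = box l' u'"
    by (auto simp: box_def Basis_complex_def Basis_vec_def l'_def u'_def inner_axis forall_2)
  then have "emeasure (distr lborel borel ?f) (box l u) = emeasure lborel (box l' u')"
    using meas by (subst emeasure_distr) auto
  also have "\<dots> = ennreal (\<Prod>b\<in>Basis. (u' - l') \<bullet> b)"
    using le' by (rule emeasure_lborel_box)
  also have "(\<Prod>b\<in>Basis. (u' - l') \<bullet> b) = (\<Prod>b\<in>Basis. (u - l) \<bullet> b)"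
  proof -
    have B: "(Basis :: (real^2) set) = {axis 1 1, axis 2 1}"
      by (auto simp: Basis_vec_def) (metis exhaust_2)
    have "axis 1 1 \<noteq> (axis 2 1 :: real^2)"
      by (simp add: axis_eq_axis)
    then show ?thesis
      unfolding B by (simp add: Basis_complex_def l'_def u'_def inner_axis complex_eq_iff)
  qed
  finally show "emeasure (distr lborel borel ?f) (box l u) = (\<Prod>b\<in>Basis. (u - l) \<bullet> b)" .
qed simp

lemma measure_triangle_complex:
  fixes a b c :: complex
  shows "measure lebesgue (interior (convex hull {a, b, c})) = \<bar>Im (cnj (b - a) * (c - b))\<bar> / 2"
proof -
  let ?f = "\<lambda>v :: real^2. Complex (v $ 1) (v $ 2)"
  define g :: "complex \<Rightarrow> real^2" where "g z = vector [Re z, Im z]" for z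
  have meas: "?f \<in> borel_measurable borel"
    by (intro borel_measurable_continuous_onI) (auto simp: complex_eq intro!: continuous_intros)
  have inv: "?f (g z) = z" "g (?f v) = v" for z v
    by (auto simp: g_def complex_eq_iff vec_eq_iff forall_2)
  have lin: "linear g"
    by (intro linearI) (auto simp: g_def vec_eq_iff forall_2)
  have "?f -` (convex hull {a, b, c}) = g ` (convex hull {a, b, c})"
    using inv by (auto simp: image_iff) metis+
  also have "\<dots> = convex hull {g a, g b, g c}"
    using convex_hull_linear_image[OF lin, of "{a, b, c}"] by simp
  finally have vim: "?f -` (convex hull {a, b, c}) = convex hull {g a, g b, g c}" .
  have cl: "closed (convex hull {a, b, c})"
    by (simp add: finite_imp_compact_convex_hull compact_imp_closed)
  have bd: "bounded (convex hull {a, b, c})"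
    by (simp add: finite_imp_bounded_convex_hull)
  have "measure lebesgue (interior (convex hull {a, b, c})) = measure lebesgue (convex hull {a, b, c})"
    using bd by (intro measure_interior) (auto simp: negligible_convex_frontier)
  also have "\<dots> = measure lborel (convex hull {a, b, c})"
    using cl by (intro measure_completion) auto
  also have "\<dots> = measure (distr lborel borel ?f) (convex hull {a, b, c})"
    by (simp add: distr_lborel_real2_complex)
  also have "\<dots> = measure lborel (convex hull {g a, g b, g c})"
    using cl meas by (subst measure_distr) (auto simp: vim)
  also have "\<dots> = \<bar>Im (cnj (b - a) * (c - b))\<bar> / 2"
    unfolding content_triangle by (simp add: g_def algebra_simps)
  finally show ?thesis .
qed

text \<open>The sign \<open>\<epsilon>\<close> is the orientation of the triangle. In the degenerate
  case its value is immaterial, as the interior is empty.\<close>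

lemma winding_number_triangle_indicator:
  fixes a b c :: complex
  obtains \<epsilon> :: real where
    "\<And>z. z \<notin> closed_segment a b \<union> closed_segment b c \<union> closed_segment c a \<Longrightarrow>
      winding_number (linepath a b +++ linepath b c +++ linepath c a) z =
        of_real (\<epsilon> * indicator (interior (convex hull {a, b, c})) z)"
    and "\<epsilon> * measure lebesgue (interior (convex hull {a, b, c})) = Im (cnj (b - a) * (c - b)) / 2"
proof
  define S where "S = Im (cnj (b - a) * (c - b))"
  define \<epsilon> :: real where "\<epsilon> = (if S > 0 then 1 else -1)"
  let ?T = "convex hull {a, b, c}" and ?p = "linepath a b +++ linepath b c +++ linepath c a"
  show "\<epsilon> * measure lebesgue (interior ?T) = S / 2"
    unfolding measure_triangle_complex S_def[symmetric] by (simp add: \<epsilon>_def)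
  fix z assume z: "z \<notin> closed_segment a b \<union> closed_segment b c \<union> closed_segment c a"
  have img: "path_image ?p = closed_segment a b \<union> closed_segment b c \<union> closed_segment c a"
    by (simp add: path_image_join Un_assoc)
  show "winding_number ?p z = of_real (\<epsilon> * indicator (interior ?T) z)"
  proof (cases "z \<in> interior ?T")
    case True
    then have "z \<in> ?T"
      using interior_subset by blast
    then obtain u v w where uvw: "0 \<le> u" "0 \<le> v" "0 \<le> w" "u + v + w = 1"
      and zeq: "z = u *\<^sub>R a + v *\<^sub>R b + w *\<^sub>R c"
      unfolding convex_hull_3 by blast
    have "w \<noteq> 0"
    proof
      assume "w = 0"
      then have "u = 1 - v"
        using uvw(4) by simp
      then have "z = (1 - v) *\<^sub>R a + v *\<^sub>R b" "0 \<le> v" "v \<le> 1"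
        using \<open>w = 0\<close> uvw zeq by simp_all
      then have "z \<in> closed_segment a b"
        unfolding closed_segment_def by blast
      with z show False by blast
    qed
    have u: "u = 1 - v - w"
      using uvw(4) by simp
    \<comment> \<open>The orientation test in \<open>winding_number_triangle\<close> is
      \<open>S\<close> times the barycentric weight of \<open>c\<close>, which is positive off the
      side from \<open>a\<close> to \<open>b\<close>.\<close>
    have "Im ((b - a) * cnj (b - z)) = w * S"
      unfolding zeq u S_def by (simp add: algebra_simps)
    then have "0 < Im ((b - a) * cnj (b - z)) \<longleftrightarrow> 0 < S"
      using \<open>w \<noteq> 0\<close> uvw(3) by (simp add: zero_less_mult_iff)
    then show ?thesis
      using winding_number_triangle[OF True] True by (simp add: \<epsilon>_def)
  next
    case False
    have "closed ?T"
      by (simp add: finite_imp_compact_convex_hull compact_imp_closed)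
    then have "z \<notin> ?T"
      using False z frontier_of_triangle[of a b c] by (auto simp: frontier_def)
    moreover have "path_image ?p \<subseteq> ?T"
      unfolding img by (intro Un_least closed_segment_subset) (auto simp: hull_inc)
    ultimately have "winding_number ?p z = 0"
      by (intro winding_number_zero_outside[of _ ?T]) auto
    with False show ?thesis
      by simp
  qed
qed

text \<open>Each of the two diagonals is traversed once in either direction, so their contributions
  cancel.\<close>

lemma winding_number_pentagon_fan:
  assumes z: "z \<notin> path_image (pentagon_path V)" "z \<notin> closed_segment (V 1) (V 3)"
    "z \<notin> closed_segment (V 1) (V 4)"
  shows "winding_number (pentagon_path V) z =
    winding_number (linepath (V 1) (V 2) +++ linepath (V 2) (V 3) +++ linepath (V 3) (V 1)) z +
    winding_number (linepath (V 1) (V 3) +++ linepath (V 3) (V 4) +++ linepath (V 4) (V 1)) z +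
    winding_number (linepath (V 1) (V 4) +++ linepath (V 4) (V 5) +++ linepath (V 5) (V 1)) z"
proof -
  have rev: "winding_number (linepath x y) z = - winding_number (linepath y x) z"
    if "z \<notin> closed_segment y x" for x y
    using winding_number_reversepath[of "linepath y x" z] that by simp
  have z': "z \<notin> closed_segment (V 3) (V 1)" "z \<notin> closed_segment (V 4) (V 1)"
    using z by (simp_all add: closed_segment_commute)
  show ?thesis
    using z z' rev[of "V 1" "V 3"] rev[of "V 1" "V 4"]
    by (simp add: path_image_pentagon_path) (simp add: pentagon_path_def winding_number_join path_image_join)
qed

text \<open>Off the null set of sides and diagonals, the winding number is a constant sign times the
  indicator of the inside, and also the sum of the signed indicators of the fan triangles.
  Integrating both gives the area up to sign.\<close>

lemma pentagon_area_eq_shoelace: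
  assumes simple: "simple_path (pentagon_path V)"
  shows "pentagon_area V = \<bar>shoelace V\<bar>"
proof -
  let ?p = "pentagon_path V" and ?T = "\<lambda>a b c. interior (convex hull {a, b, c :: complex})"
  let ?T1 = "?T (V 1) (V 2) (V 3)" and ?T2 = "?T (V 1) (V 3) (V 4)" and ?T3 = "?T (V 1) (V 4) (V 5)"
  obtain \<epsilon>1 where \<epsilon>1: "\<And>z. z \<notin> closed_segment (V 1) (V 2) \<union> closed_segment (V 2) (V 3) \<union> closed_segment (V 3) (V 1) \<Longrightarrow>
      winding_number (linepath (V 1) (V 2) +++ linepath (V 2) (V 3) +++ linepath (V 3) (V 1)) z =
        of_real (\<epsilon>1 * indicator ?T1 z)"
    "\<epsilon>1 * measure lebesgue ?T1 = Im (cnj (V 2 - V 1) * (V 3 - V 2)) / 2"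
    using winding_number_triangle_indicator[of "V 1" "V 2" "V 3"] by blast
  obtain \<epsilon>2 where \<epsilon>2: "\<And>z. z \<notin> closed_segment (V 1) (V 3) \<union> closed_segment (V 3) (V 4) \<union> closed_segment (V 4) (V 1) \<Longrightarrow>
      winding_number (linepath (V 1) (V 3) +++ linepath (V 3) (V 4) +++ linepath (V 4) (V 1)) z =
        of_real (\<epsilon>2 * indicator ?T2 z)"
    "\<epsilon>2 * measure lebesgue ?T2 = Im (cnj (V 3 - V 1) * (V 4 - V 3)) / 2"
    using winding_number_triangle_indicator[of "V 1" "V 3" "V 4"] by blast
  obtain \<epsilon>3 where \<epsilon>3: "\<And>z. z \<notin> closed_segment (V 1) (V 4) \<union> closed_segment (V 4) (V 5) \<union> closed_segment (V 5) (V 1) \<Longrightarrow>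
      winding_number (linepath (V 1) (V 4) +++ linepath (V 4) (V 5) +++ linepath (V 5) (V 1)) z =
        of_real (\<epsilon>3 * indicator ?T3 z)"
    "\<epsilon>3 * measure lebesgue ?T3 = Im (cnj (V 4 - V 1) * (V 5 - V 4)) / 2"
    using winding_number_triangle_indicator[of "V 1" "V 4" "V 5"] by blast
  obtain \<sigma> :: real where \<sigma>: "\<bar>\<sigma>\<bar> = 1"
    "\<And>z. z \<in> inside (path_image ?p) \<Longrightarrow> winding_number ?p z = of_real \<sigma>"
    using simple_closed_path_winding_number_inside[OF simple]
    by (metis abs_1 abs_minus_cancel of_real_1 of_real_minus)
  define N where "N = path_image ?p \<union> closed_segment (V 1) (V 3) \<union> closed_segment (V 1) (V 4)"
  have "negligible (closed_segment a b)" for a b :: complex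
    using negligible_convex_interior[of "closed_segment a b"] by (simp add: interior_closed_segment_ge2)
  then have "negligible N"
    unfolding N_def path_image_pentagon_path by (intro negligible_Un)
  then have ae: "AE z in lebesgue. z \<notin> N"
    by (simp add: AE_not_in negligible_iff_null_sets)
  have lm: "S \<in> lmeasurable" if "open S" "bounded S" for S :: "complex set"
    using that by (simp add: bounded_set_imp_lmeasurable borel_open)
  have T: "?T a b c \<in> lmeasurable" for a b c
    by (intro lm bounded_interior) (auto simp: finite_imp_bounded_convex_hull)
  have I: "inside (path_image ?p) \<in> lmeasurable"
    by (intro lm open_inside bounded_inside closed_path_image bounded_path_image path_pentagon_path)
  have "\<sigma> * indicator (inside (path_image ?p)) z =
      \<epsilon>1 * indicator ?T1 z + \<epsilon>2 * indicator ?T2 z + \<epsilon>3 * indicator ?T3 z"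
    if "z \<notin> N" for z
  proof -
    have z: "z \<notin> path_image ?p" "z \<notin> closed_segment (V 1) (V 3)" "z \<notin> closed_segment (V 1) (V 4)"
      using that by (auto simp: N_def)
    then have z': "z \<notin> closed_segment (V 3) (V 1)" "z \<notin> closed_segment (V 4) (V 1)"
      by (simp_all add: closed_segment_commute)
    have wn: "winding_number ?p z = of_real (\<sigma> * indicator (inside (path_image ?p)) z)"
    proof (cases "z \<in> inside (path_image ?p)")
      case False
      then have "z \<in> outside (path_image ?p)"
        using z(1) inside_Un_outside by blast
      then show ?thesis
        using False winding_number_zero_in_outside path_pentagon_path by simp
    qed (simp add: \<sigma>)
    have "winding_number ?p z =
        of_real (\<epsilon>1 * indicator ?T1 z) + of_real (\<epsilon>2 * indicator ?T2 z) + of_real (\<epsilon>3 * indicator ?T3 z)"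
      unfolding winding_number_pentagon_fan[OF z]
      by (intro arg_cong2[where f = "(+)"] \<epsilon>1(1) \<epsilon>2(1) \<epsilon>3(1))
        (use z z' in \<open>auto simp: path_image_pentagon_path\<close>)
    then show ?thesis
      unfolding wn of_real_add[symmetric] of_real_eq_iff .
  qed
  then have "integral\<^sup>L lebesgue (\<lambda>z. \<sigma> * indicator (inside (path_image ?p)) z) =
      integral\<^sup>L lebesgue (\<lambda>z. \<epsilon>1 * indicator ?T1 z + \<epsilon>2 * indicator ?T2 z + \<epsilon>3 * indicator ?T3 z)"
    using T I ae by (intro integral_cong_AE) (auto simp: fmeasurableD elim: eventually_mono)
  also have "\<dots> = \<epsilon>1 * measure lebesgue ?T1 + \<epsilon>2 * measure lebesgue ?T2 + \<epsilon>3 * measure lebesgue ?T3"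
    using T by (simp add: fmeasurable_def)
  also have "\<dots> = shoelace V"
    unfolding \<epsilon>1(2) \<epsilon>2(2) \<epsilon>3(2) by (simp add: shoelace_def add_divide_distrib)
  finally have "\<sigma> * measure lebesgue (inside (path_image ?p)) = shoelace V"
    using I by (simp add: fmeasurable_def)
  then show ?thesis
    using \<sigma>(1) unfolding pentagon_area_def pentagon_region_def
    by (metis abs_mult abs_of_nonneg measure_nonneg mult_1)
qed

section \<open>Convex tangential pentagons\<close>

lemma chordal_cnj:
  assumes "chordal (\<lambda>j. cnj (V j))"
  shows "chordal V"
proof -
  obtain c r where "r > 0" and on: "\<forall>j\<in>{1..5}. cnj (V j) \<in> sphere c r"
    using assms by (auto simp: chordal_def)
  have "dist (cnj c) z = dist c (cnj z)" for z
    by (metis complex_cnj_cnj complex_cnj_diff complex_mod_cnj dist_norm)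
  with on have "\<forall>j\<in>{1..5}. V j \<in> sphere (cnj c) r"
    by simp
  with \<open>r > 0\<close> show ?thesis
    unfolding chordal_def by blast
qed

lemma configuration_cnj: "configuration a (\<lambda>j. cnj (V j)) \<longleftrightarrow> configuration a V"
proof -
  have "dist (cnj y) (cnj z) = dist y z" for y z
    by (metis complex_cnj_diff complex_mod_cnj dist_norm)
  then show ?thesis
    by (simp add: configuration_def)
qed

lemma shoelace_cnj: "shoelace (\<lambda>j. cnj (V j)) = - shoelace V"
  by (simp add: shoelace_def field_simps)

theorem theorem2:
  fixes a :: "nat \<Rightarrow> real" and X :: "nat \<Rightarrow> complex" and A :: real
  assumes "\<forall>j\<in>{1..5}. a j > 0"
    and "configuration a X"
    and "convex_pentagon X"
    and "tangential X"
    and "A = pentagon_area X"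
    and "maximal_real_root (robbins_poly a) (16 * A\<^sup>2)"
  shows "bicentric X"
proof -
  let ?J = "{1..5::nat}"
  have simple: "simple_path (pentagon_path X)"
    using assms(3) by (simp add: convex_pentagon_def)
  obtain m where m: "m \<in> ?J" "\<forall>j\<in>?J. a j \<le> a m"
  proof -
    have "Max (a ` ?J) \<in> a ` ?J"
      by (intro Max_in) auto
    then obtain m where "m \<in> ?J" "a m = Max (a ` ?J)"
      by (metis imageE)
    then show ?thesis
      by (intro that[of m]) auto
  qed
  obtain \<theta> R where th: "\<forall>j\<in>?J. 0 < \<theta> j" "sum \<theta> ?J = pi" "\<forall>j\<in>?J. a j = 2 * R * sin (\<theta> j)"
    using cyclic_angles_exist[OF _ assms(1) m simple_pentagon_side_less[OF simple assms(2) m(1)]]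
    by blast
  define M where "M = (\<Sum>j\<in>?J. cot (\<theta> j) * (a j)\<^sup>2) / 4"
  \<comment> \<open>Rewrites \<open>16 * M\<^sup>2\<close> as the root found in
    \<open>robbins_root_cyclic\<close>.\<close>
  have "cot (\<theta> j) * (a j)\<^sup>2 = 2 * R\<^sup>2 * sin (2 * \<theta> j)" if "j \<in> ?J" for j
  proof -
    have "sin (\<theta> j) \<noteq> 0"
      using assms(1) th(3) that by fastforce
    moreover have "a j = 2 * R * sin (\<theta> j)"
      using th(3) that by blast
    ultimately show ?thesis
      by (simp add: cot_def sin_double power2_eq_square)
  qed
  then have "(\<Sum>j\<in>?J. cot (\<theta> j) * (a j)\<^sup>2) = (\<Sum>j\<in>?J. 2 * R\<^sup>2 * sin (2 * \<theta> j))"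
    by (rule sum.cong[OF refl])
  then have "4 * M = 2 * R\<^sup>2 * (\<Sum>j\<in>?J. sin (2 * \<theta> j))"
    by (simp add: M_def flip: sum_distrib_left)
  then have "(4 * M)\<^sup>2 = (2 * R\<^sup>2 * (\<Sum>j\<in>?J. sin (2 * \<theta> j)))\<^sup>2"
    by (simp only:)
  then have "16 * M\<^sup>2 = 4 * R ^ 4 * (\<Sum>j\<in>?J. sin (2 * \<theta> j))\<^sup>2"
    by (simp add: power_mult_distrib)
  then have "poly (robbins_poly a) (16 * M\<^sup>2) = 0"
    using robbins_root_cyclic[OF th(2,3)] by (simp only:)
  then have "16 * M\<^sup>2 \<le> 16 * A\<^sup>2"
    using assms(6) unfolding maximal_real_root_def by blast
  then have le: "M\<^sup>2 \<le> A\<^sup>2"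
    by simp
  have A: "A = \<bar>shoelace X\<bar>"
    using pentagon_area_eq_shoelace[OF simple] assms(5) by simp
  note bound = shoelace_bound[OF th(1,2) assms(2), folded M_def]
  \<comment> \<open>The mirror image has the opposite signed area, so the bound holds for both
    orientations of \<open>X\<close>.\<close>
  note bound_cnj = shoelace_bound[OF th(1,2) iffD2[OF configuration_cnj assms(2)], folded M_def,
      unfolded shoelace_cnj]
  have "A \<le> M"
    using A bound(1) bound_cnj(1) by simp
  moreover have "M \<le> A"
    by (rule power2_le_imp_le[OF le]) (simp add: A)
  ultimately have "\<bar>shoelace X\<bar> = M"
    using A by linarith
  then have "shoelace X = M \<or> - shoelace X = M"
    by linarith
  moreover have "X 1 \<noteq> X 2"
    using assms(1,2) by (auto simp: configuration_def nxt_def numeral_2_eq_2 dest!: bspec[of _ _ 1])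
  then have "cnj (X 1) \<noteq> cnj (X 2)"
    by simp
  ultimately have "chordal X"
    using bound(2)[OF _ \<open>X 1 \<noteq> X 2\<close>] bound_cnj(2)[THEN chordal_cnj] by blast
  with assms(4) show ?thesis
    by (simp add: bicentric_def)
qed

end
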